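(* Let $I_0$ be a dyadic interval, let $\mathcal{D}(I_0)$ be the (finite) dyadic tree originating at $I_0$, let $\Lambda=\{\lambda_I\}_{I\in\mathcal{D}(I_0)}$ be a collection of non-negative numbers (a measure on the tree), and let $\{\alpha_I\}_{I\in\mathcal{D}(I_0)}$ be a sequence of non-negative numbers. If $$\frac{1}{|I|}\sum_{K\subset I}\alpha_K(\Lambda)_K^2\le(\Lambda)_I\qquad\text{for all }I\in\mathcal{D}(I_0),$$ then for every function $\varphi:\mathcal{D}(I_0)\to\mathbb{R}$, $$\frac{1}{|I_0|}\sum_{I\subset I_0}\alpha_I\,(\varphi\sqrt{\Lambda})_I^2\le 4\,(\varphi^2)_{I_0},$$ where $$(\varphi\sqrt{\Lambda})_I:=\frac{1}{|I|}\sum_{K\subset I}\varphi(K)\sqrt{\lambda_K},\qquad(\varphi^2)_{I_0}:=\frac{1}{|I_0|}\sum_{I\subset I_0}\varphi(I)^2.$$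
   Context: The dyadic tree $\mathcal{D}(I_0)$ consists of the dyadic subintervals of $I_0$ (including $I_0$) of length at least $2^{-N}|I_0|$, where $N$ is an arbitrary non-negative integer. All sums over $K\subset I$ run over $K\in\mathcal{D}(I_0)$ with $K\subset I$ (including $K=I$). For $I\in\mathcal{D}(I_0)$, $|I|$ is the length of $I$, $\Lambda(I):=\sum_{K\subset I}\lambda_K$, and $(\Lambda)_I:=\frac{1}{|I|}\Lambda(I)$. *)

theory Defs
  imports "HOL-Analysis.Analysis"
begin

definition dyadic_interval :: "real set \<Rightarrow> bool" where
  "dyadic_interval I \<longleftrightarrow>
     (\<exists>n k :: int. I = {of_int k * 2 powi (- n) ..< (of_int k + 1) * 2 powi (- n)})"

abbreviation len :: "real set \<Rightarrow> real" where
  "len I \<equiv> measure lborel I"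

definition dyadic_tree :: "nat \<Rightarrow> real set \<Rightarrow> real set set" where
  "dyadic_tree N I0 = {K. dyadic_interval K \<and> K \<subseteq> I0 \<and> len K \<ge> (1 / 2) ^ N * len I0}"

definition subtree :: "nat \<Rightarrow> real set \<Rightarrow> real set \<Rightarrow> real set set" where
  "subtree N I0 I = {K \<in> dyadic_tree N I0. K \<subseteq> I}"

text \<open>The normalisation is by the length of the interval, not by the number of nodes or by the
  measure of the tree. Applied to \<open>\<lambda>\<close>, \<open>\<phi> \<sqrt>\<lambda>\<close> and \<open>\<phi>\<^sup>2\<close> it gives \<open>(\<Lambda>)\<^sub>I\<close>,
  \<open>(\<phi> \<sqrt>\<Lambda>)\<^sub>I\<close> and \<open>(\<phi>\<^sup>2)\<^sub>I\<close>.\<close>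

definition tree_avg :: "nat \<Rightarrow> real set \<Rightarrow> (real set \<Rightarrow> real) \<Rightarrow> real set \<Rightarrow> real" where
  "tree_avg N I0 f I = (1 / len I) * (\<Sum>K\<in>subtree N I0 I. f K)"

lemma len_dyadic:
  "len {of_int k * 2 powi (- n) ..< (of_int k + 1) * 2 powi (- n)} = 2 powi (- n)"
  by (simp add: algebra_simps)

text \<open>All sums over the tree are therefore genuine finite sums.\<close>

lemma finite_dyadic_tree:
  assumes "dyadic_interval I0"
  shows "finite (dyadic_tree N I0)"
proof -
  obtain n0 k0 :: int
    where I0: "I0 = {of_int k0 * 2 powi (- n0) ..< (of_int k0 + 1) * 2 powi (- n0)}"
    using assms unfolding dyadic_interval_def by blast
  define B :: int where "B = (\<bar>k0\<bar> + 1) * 2 ^ N"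
  let ?F = "\<lambda>(n :: int, k :: int). {of_int k * 2 powi (- n) ..< (of_int k + 1) * 2 powi (- n) :: real}"
  have "dyadic_tree N I0 \<subseteq> ?F ` ({n0..n0 + int N} \<times> {- B..B})"
  proof
    fix K assume "K \<in> dyadic_tree N I0"
    then obtain n k :: int
      where K: "K = {of_int k * 2 powi (- n) ..< (of_int k + 1) * 2 powi (- n)}"
        and sub: "K \<subseteq> I0" and le: "(1 / 2) ^ N * len I0 \<le> len K"
      unfolding dyadic_tree_def dyadic_interval_def by blast
    have "(1 / 2) ^ N * 2 powi (- n0) \<le> (2 powi (- n) :: real)"
      using le unfolding I0 K len_dyadic .
    moreover have "(1 / 2) ^ N * 2 powi (- n0) = (2 powi (- n0 - int N) :: real)"
      by (simp add: power_int_diff power_divide)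
    ultimately have "(2 powi (- n0 - int N) :: real) \<le> 2 powi (- n)"
      by simp
    then have up: "n \<le> n0 + int N"
      using power_int_strict_increasing[of "- n" "- n0 - int N" "2 :: real"] by linarith
    have "len K \<le> len I0"
      by (rule measure_mono_fmeasurable)
        (use sub in \<open>simp_all add: I0 K fmeasurable_def emeasure_lborel_Ico\<close>)
    then have "(2 powi (- n) :: real) \<le> 2 powi (- n0)"
      unfolding I0 K len_dyadic .
    then have low: "n0 \<le> n"
      using power_int_strict_increasing[of "- n0" "- n" "2 :: real"] by linarith
    have pos: "(0 :: real) < 2 powi (- n)" "(0 :: real) < 2 powi (- n0)"
      by simp_all
    have "of_int k * 2 powi (- n) \<in> K"
      using pos unfolding K by (simp add: algebra_simps)
    then have "of_int k * 2 powi (- n) \<in> I0"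
      using sub by blast
    moreover have "\<bar>of_int k0 * 2 powi (- n0)\<bar> = \<bar>of_int k0\<bar> * (2 powi (- n0) :: real)"
      by (simp add: abs_mult)
    ultimately have "\<bar>of_int k * 2 powi (- n)\<bar> \<le> (\<bar>of_int k0\<bar> + 1) * (2 powi (- n0) :: real)"
      unfolding I0 distrib_right using pos(2) by (auto simp: abs_le_iff)
    then have "\<bar>of_int k\<bar> * (2 powi (- n) * 2 powi n)
        \<le> (\<bar>of_int k0\<bar> + 1) * (2 powi (- n0) * 2 powi n :: real)"
      using mult_right_mono[of _ _ "2 powi n :: real"] by (simp add: abs_mult mult.assoc)
    then have "\<bar>of_int k\<bar> \<le> (\<bar>of_int k0\<bar> + 1) * (2 powi (n - n0) :: real)"
      by (simp add: power_int_minus power_int_diff field_simps)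
    also have "\<dots> \<le> (\<bar>of_int k0\<bar> + 1) * 2 powi (int N)"
      using up by (intro mult_left_mono power_int_increasing) auto
    also have "\<dots> = of_int B"
      by (simp add: B_def)
    finally have "\<bar>k\<bar> \<le> B"
      by linarith
    then show "K \<in> ?F ` ({n0..n0 + int N} \<times> {- B..B})"
      using up low K by (intro image_eqI[of _ _ "(n, k)"]) auto
  qed
  then show ?thesis
    by (rule finite_subset) auto
qed

end

theory Submission
  imports Defs
begin

text \<open>After absorbing the lengths into the weights \<open>a\<^sub>K = \<alpha>\<^sub>K / |K|\<^sup>2\<close>, only the nesting of the
  intervals matters. For \<open>\<Lambda>\<close>, \<open>F\<close>, \<open>\<Phi>\<close>, \<open>S\<close>, \<open>A\<close> the sums of
  \<open>\<lambda>\<close>, \<open>\<phi> \<sqrt>\<lambda>\<close>, \<open>\<phi>\<^sup>2\<close>, \<open>a F\<^sup>2\<close>, \<open>a \<Lambda>\<^sup>2\<close> below a node, the Bellman-function bound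
  \<open>S \<le> 4 (\<Phi> - F\<^sup>2 / (\<Lambda> + A))\<close> propagates from the children of a node to the node itself: the
  own mass of the node is absorbed by Cauchy-Schwarz, and the new term \<open>a F\<^sup>2\<close> is paid for by the
  growth of \<open>A\<close>, since \<open>\<Lambda> + A \<le> 2 \<Lambda>\<close>.\<close>

definition below :: "'a set set \<Rightarrow> 'a set \<Rightarrow> 'a set set" where
  "below T I = {K \<in> T. K \<subseteq> I}"

definition laminar :: "'a set set \<Rightarrow> bool" where
  "laminar T \<longleftrightarrow> (\<forall>X\<in>T. \<forall>Y\<in>T. X \<subseteq> Y \<or> Y \<subseteq> X \<or> disjnt X Y)"

lemma finite_below: "finite T \<Longrightarrow> finite (below T I)"
  by (simp add: below_def)

text \<open>\<open>C\<close> consists of the maximal members of \<open>T\<close> strictly inside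
  \<open>I\<close>. By maximality neither of two distinct ones contains the other, so laminarity
  makes them disjoint. A common descendant would then be empty, which \<open>ne\<close> excludes,
  and so the families below the children partition the proper descendants of
  \<open>I\<close>.\<close>

lemma laminar_children:
  assumes fin: "finite T" and lam: "laminar T" and ne: "{} \<notin> T" and I: "I \<in> T"
  obtains C where "C \<subseteq> T" "\<And>J. J \<in> C \<Longrightarrow> J \<subset> I"
    "\<And>f :: 'a set \<Rightarrow> real. sum f (below T I) = f I + (\<Sum>J\<in>C. sum f (below T J))"
proof -
  define U where "U = {K \<in> T. K \<subset> I}"
  define C where "C = {J \<in> U. \<forall>K\<in>U. J \<subseteq> K \<longrightarrow> K = J}"
  have finU: "finite U"
    using fin by (simp add: U_def)
  have "\<exists>J\<in>C. K \<subseteq> J" if "K \<in> U" for K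
    using finite_has_maximal2[OF finU that] by (auto simp: C_def)
  then have "U \<subseteq> (\<Union>J\<in>C. below T J)"
    by (auto simp: U_def below_def)
  moreover have "(\<Union>J\<in>C. below T J) \<subseteq> U"
    unfolding C_def U_def below_def by blast
  ultimately have UC: "U = (\<Union>J\<in>C. below T J)" ..
  have disj: "below T J \<inter> below T J' = {}" if J: "J \<in> C" "J' \<in> C" "J \<noteq> J'" for J J'
  proof -
    have "J \<in> T" "J' \<in> T" "\<not> J \<subseteq> J'" "\<not> J' \<subseteq> J"
      using J by (auto simp only: C_def U_def mem_Collect_eq)
    then have "disjnt J J'"
      using lam by (auto simp only: laminar_def)
    then have "K = {}" if "K \<subseteq> J" "K \<subseteq> J'" for K
      using that by (auto simp: disjnt_def)
    then show ?thesis
      using ne by (auto simp: below_def)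
  qed
  have "sum f (below T I) = f I + (\<Sum>J\<in>C. sum f (below T J))" for f :: "'a set \<Rightarrow> real"
  proof -
    have "below T I = insert I U" "I \<notin> U"
      using I by (auto simp: below_def U_def)
    then have "sum f (below T I) = f I + sum f U"
      using finU by simp
    also have "sum f U = (\<Sum>J\<in>C. sum f (below T J))"
      unfolding UC by (rule sum.UNION_disjoint)
        (use finU disj finite_below[OF fin] in \<open>auto simp: C_def\<close>)
    finally show ?thesis .
  qed
  moreover have "C \<subseteq> T" "\<And>J. J \<in> C \<Longrightarrow> J \<subset> I"
    by (auto simp: C_def U_def)
  ultimately show thesis
    using that by blast
qed

text \<open>Adding the term of weight \<open>a\<close> at a node. The minimiser
  \<open>t = F / (L + A)\<close> turns \<open>IH\<close> into the bound by
  \<open>4 * P - 4 * F\<^sup>2 / (L + A)\<close>. Enlarging the denominator by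
  \<open>a * L\<^sup>2\<close> frees enough to pay for \<open>a * F\<^sup>2\<close>, and completing
  a square returns to the dual form at \<open>s\<close>.\<close>

lemma bellman_step:
  fixes a F L A S P s :: real
  assumes a: "0 \<le> a" and A: "0 \<le> A" and L: "0 \<le> L" and FL: "L = 0 \<Longrightarrow> F = 0"
    and carleson: "A + a * L\<^sup>2 \<le> L"
    and IH: "\<And>t. S \<le> 4 * P - 8 * t * F + 4 * t\<^sup>2 * (L + A)"
  shows "S + a * F\<^sup>2 \<le> 4 * P - 8 * s * F + 4 * s\<^sup>2 * (L + (A + a * L\<^sup>2))"
proof (cases "L = 0")
  case True
  then have "S + a * F\<^sup>2 \<le> 4 * P"
    using IH[of 0] FL by simp
  also have "\<dots> \<le> 4 * P - 8 * s * F + 4 * s\<^sup>2 * (L + (A + a * L\<^sup>2))"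
    using True FL A by simp
  finally show ?thesis .
next
  case False
  define Q where "Q = L + A"
  define R where "R = Q + a * L\<^sup>2"
  have pos: "0 < L" "0 < Q" "0 < R" "Q \<le> R" "R \<le> 2 * L"
    using False L A a carleson by (auto simp: Q_def R_def intro: add_pos_nonneg)
  \<comment> \<open>The constant 4 of the theorem arises here: the Carleson condition gives
    \<open>R \<le> 2 * L\<close>, and \<open>Q \<le> R\<close>.\<close>
  have "Q * R \<le> (2 * L) * (2 * L)"
    using pos by (intro mult_mono) auto
  then have "a * F\<^sup>2 * (Q * R) \<le> a * F\<^sup>2 * (4 * L\<^sup>2)"
    using a by (intro mult_left_mono) (auto simp: power2_eq_square)
  also have "\<dots> = 4 * F\<^sup>2 * (R - Q)"
    by (simp add: R_def)
  also have "\<dots> = (4 * (F\<^sup>2 / Q) - 4 * (F\<^sup>2 / R)) * (Q * R)"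
    using pos by (simp add: field_simps)
  finally have gain: "a * F\<^sup>2 \<le> 4 * (F\<^sup>2 / Q) - 4 * (F\<^sup>2 / R)"
    using pos by simp
  have "- 8 * (F / Q) * F + 4 * (F / Q)\<^sup>2 * Q = - 4 * (F\<^sup>2 / Q)"
    using pos by (simp add: power2_eq_square)
  then have "S \<le> 4 * P - 4 * (F\<^sup>2 / Q)"
    using IH[of "F / Q"] by (simp add: Q_def)
  moreover have "0 \<le> 4 * (F - s * R)\<^sup>2 / R"
    using pos by simp
  then have "0 \<le> 4 * (F\<^sup>2 / R) - 8 * s * F + 4 * s\<^sup>2 * R"
    using pos by (simp add: field_simps power2_eq_square)
  ultimately show ?thesis
    using gain by (simp add: R_def Q_def add.assoc)
qed

text \<open>The bound \<open>S \<le> 4 (\<Phi> - F\<^sup>2 / (\<Lambda> + A))\<close> in dual form, optimised over \<open>t\<close>: it is additive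
  over children and has no division by a possibly vanishing \<open>\<Lambda>\<close>.\<close>

lemma laminar_bellman_bound:
  fixes T :: "'a set set" and l a \<phi> :: "'a set \<Rightarrow> real" and t :: real
  defines "L \<equiv> \<lambda>I. sum l (below T I)"
    and "F \<equiv> \<lambda>I. \<Sum>K\<in>below T I. \<phi> K * sqrt (l K)"
  assumes fin: "finite T" and lam: "laminar T" and ne: "{} \<notin> T"
    and l: "\<And>K. K \<in> T \<Longrightarrow> 0 \<le> l K" and a: "\<And>K. K \<in> T \<Longrightarrow> 0 \<le> a K"
    and carleson: "\<And>I. I \<in> T \<Longrightarrow> (\<Sum>K\<in>below T I. a K * (L K)\<^sup>2) \<le> L I"
    and I: "I \<in> T"
  shows "(\<Sum>K\<in>below T I. a K * (F K)\<^sup>2) \<le>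
    4 * (\<Sum>K\<in>below T I. (\<phi> K)\<^sup>2) - 8 * t * F I
      + 4 * t\<^sup>2 * (L I + (\<Sum>K\<in>below T I. a K * (L K)\<^sup>2))"
  using I
proof (induction "card (below T I)" arbitrary: I t rule: less_induct)
  case less
  note I = less.prems
  \<comment> \<open>At a minimal node \<open>C\<close> is empty, so the induction has no separate
    base case.\<close>
  obtain C where C: "C \<subseteq> T" "\<And>J. J \<in> C \<Longrightarrow> J \<subset> I"
    and split: "\<And>f :: 'a set \<Rightarrow> real. sum f (below T I) = f I + (\<Sum>J\<in>C. sum f (below T J))"
    using laminar_children[OF fin lam ne I] by metis
  \<comment> \<open>\<open>A\<close> and \<open>S\<close> omit the term at \<open>I\<close>, whereas
    \<open>P\<close>, \<open>F I\<close> and \<open>L I\<close> include it: the mass at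
    \<open>I\<close> enters first, the weight \<open>a I\<close> only through
    \<open>bellman_step\<close>.\<close>
  define A where "A = (\<Sum>J\<in>C. \<Sum>K\<in>below T J. a K * (L K)\<^sup>2)"
  define S where "S = (\<Sum>J\<in>C. \<Sum>K\<in>below T J. a K * (F K)\<^sup>2)"
  define P where "P = (\<Sum>K\<in>below T I. (\<phi> K)\<^sup>2)"
  have P: "P = (\<phi> I)\<^sup>2 + (\<Sum>J\<in>C. \<Sum>K\<in>below T J. (\<phi> K)\<^sup>2)"
    unfolding P_def by (rule split)
  have F: "F I = \<phi> I * sqrt (l I) + (\<Sum>J\<in>C. F J)"
    unfolding F_def by (rule split)
  have L: "L I = l I + (\<Sum>J\<in>C. L J)"
    unfolding L_def by (rule split)
  have sum_linear: "(\<Sum>J\<in>C. 4 * p J - 8 * s * f J + 4 * s\<^sup>2 * (m J + q J))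
      = 4 * sum p C - 8 * s * sum f C + 4 * s\<^sup>2 * (sum m C + sum q C)"
    for p f m q :: "'a set \<Rightarrow> real" and s
    by (simp add: sum.distrib sum_subtractf sum_distrib_left distrib_left)
  \<comment> \<open>All \<open>s\<close> are required, since \<open>bellman_step\<close> chooses its
    own parameter.\<close>
  have IH: "S \<le> 4 * P - 8 * s * F I + 4 * s\<^sup>2 * (L I + A)" for s
  proof -
    have "S \<le> (\<Sum>J\<in>C. 4 * (\<Sum>K\<in>below T J. (\<phi> K)\<^sup>2) - 8 * s * F J
      + 4 * s\<^sup>2 * (L J + (\<Sum>K\<in>below T J. a K * (L K)\<^sup>2)))"
      unfolding S_def
    proof (rule sum_mono)
      fix J assume J: "J \<in> C"
      have "below T J \<subset> below T I"
        using C(2)[OF J] I by (auto simp: below_def)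
      then have "card (below T J) < card (below T I)"
        by (rule psubset_card_mono[OF finite_below[OF fin]])
      then show "(\<Sum>K\<in>below T J. a K * (F K)\<^sup>2) \<le> 4 * (\<Sum>K\<in>below T J. (\<phi> K)\<^sup>2) - 8 * s * F J
        + 4 * s\<^sup>2 * (L J + (\<Sum>K\<in>below T J. a K * (L K)\<^sup>2))"
        using C(1) J by (intro less.hyps) auto
    qed
    also have "\<dots> = 4 * (\<Sum>J\<in>C. \<Sum>K\<in>below T J. (\<phi> K)\<^sup>2) - 8 * s * (\<Sum>J\<in>C. F J)
        + 4 * s\<^sup>2 * ((\<Sum>J\<in>C. L J) + A)"
      unfolding A_def by (rule sum_linear)
    also have "\<dots> = 4 * P - 8 * s * F I + 4 * s\<^sup>2 * (L I + A) - 4 * (\<phi> I - s * sqrt (l I))\<^sup>2"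
    proof -
      \<comment> \<open>Cauchy-Schwarz in dual form: the contribution of the mass at
        \<open>I\<close> is the perfect square \<open>4 * (x - s * r)\<^sup>2\<close>, with
        \<open>r\<^sup>2 = l I\<close>.\<close>
      have "4 * p - 8 * s * f + 4 * s\<^sup>2 * (m + A) = 4 * (x\<^sup>2 + p) - 8 * s * (x * r + f)
          + 4 * s\<^sup>2 * (r\<^sup>2 + m + A) - 4 * (x - s * r)\<^sup>2" for p f m x r :: real
        by algebra
      from this[where r = "sqrt (l I)" and x = "\<phi> I"] show ?thesis
        unfolding P F L using l[OF I] by simp
    qed
    also have "\<dots> \<le> 4 * P - 8 * s * F I + 4 * s\<^sup>2 * (L I + A)"
      by simp
    finally show ?thesis .
  qed
  have below_T: "K \<in> T" if "K \<in> below T J" for K J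
    using that by (simp add: below_def)
  have F0: "F I = 0" if "L I = 0"
  proof -
    have "\<forall>K\<in>below T I. l K = 0"
      using that l below_T finite_below[OF fin] unfolding L_def
      by (subst (asm) sum_nonneg_eq_0_iff) auto
    then show ?thesis
      by (simp add: F_def)
  qed
  have "0 \<le> A"
    unfolding A_def using a below_T by (intro sum_nonneg mult_nonneg_nonneg) auto
  moreover have "0 \<le> L I"
    unfolding L_def using l below_T by (intro sum_nonneg) auto
  moreover have A: "(\<Sum>K\<in>below T I. a K * (L K)\<^sup>2) = A + a I * (L I)\<^sup>2"
    unfolding A_def by (subst split) simp
  moreover have "(\<Sum>K\<in>below T I. a K * (F K)\<^sup>2) = S + a I * (F I)\<^sup>2"
    unfolding S_def by (subst split) simp
  ultimately show ?case
    using bellman_step[OF a[OF I] _ _ F0 _ IH] carleson[OF I]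
    by (simp add: P_def)
qed

text \<open>The Bellman bound at \<open>t = 0\<close>; the other values of \<open>t\<close> serve
  the induction.\<close>

corollary laminar_carleson_embedding:
  fixes l a \<phi> :: "'a set \<Rightarrow> real"
  assumes "finite T" "laminar T" "{} \<notin> T"
    and "\<And>K. K \<in> T \<Longrightarrow> 0 \<le> l K" and "\<And>K. K \<in> T \<Longrightarrow> 0 \<le> a K"
    and "\<And>I. I \<in> T \<Longrightarrow> (\<Sum>K\<in>below T I. a K * (sum l (below T K))\<^sup>2) \<le> sum l (below T I)"
    and "I \<in> T"
  shows "(\<Sum>K\<in>below T I. a K * (\<Sum>J\<in>below T K. \<phi> J * sqrt (l J))\<^sup>2)
    \<le> 4 * (\<Sum>K\<in>below T I. (\<phi> K)\<^sup>2)"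
  using laminar_bellman_bound[OF assms, of \<phi> 0] by simp

text \<open>In units of the finer length \<open>u\<close> both intervals have integer endpoints and
  \<open>L\<close> has length one, so it cannot straddle an endpoint of \<open>K\<close>.\<close>

lemma dyadic_interval_nested:
  fixes k l n m :: int
  defines "K \<equiv> {of_int k * 2 powi (- n) ..< (of_int k + 1) * 2 powi (- n) :: real}"
    and "L \<equiv> {of_int l * 2 powi (- m) ..< (of_int l + 1) * 2 powi (- m) :: real}"
  assumes nm: "n \<le> m"
  shows "L \<subseteq> K \<or> disjnt K L"
proof (rule disjCI)
  assume "\<not> disjnt K L"
  then obtain x where x: "x \<in> K" "x \<in> L"
    by (auto simp: disjnt_def)
  define u :: real where "u = 2 powi (- m)"
  define D :: int where "D = 2 ^ nat (m - n)"
  have u: "0 < u"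
    by (simp add: u_def)
  have "(2 :: real) powi (- n) = 2 powi (int (nat (m - n)) + (- m))"
    using nm by simp
  also have "\<dots> = 2 powi int (nat (m - n)) * u"
    unfolding u_def by (rule power_int_add) simp
  also have "2 powi int (nat (m - n)) = (of_int D :: real)"
    unfolding power_int_of_nat D_def by simp
  finally have K: "K = {of_int (k * D) * u ..< of_int ((k + 1) * D) * u}"
    by (simp add: K_def mult.assoc)
  have L: "L = {of_int l * u ..< of_int (l + 1) * u}"
    by (simp add: L_def u_def)
  have "of_int (k * D) * u < of_int (l + 1) * u" "of_int l * u < of_int ((k + 1) * D) * u"
    using x unfolding K L by (meson atLeastLessThan_iff le_less_trans)+
  then have "k * D < l + 1" "l < (k + 1) * D"
    using u by (simp_all only: mult_less_cancel_right_pos of_int_less_iff)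
  \<comment> \<open>Over the integers the strict inequalities sharpen to
    \<open>k * D \<le> l\<close> and \<open>l + 1 \<le> (k + 1) * D\<close>.\<close>
  then have "of_int (k * D) * u \<le> of_int l * u" "of_int (l + 1) * u \<le> of_int ((k + 1) * D) * u"
    using u by (intro mult_right_mono; simp only: of_int_le_iff; linarith)+
  then show "L \<subseteq> K"
    unfolding K L by auto
qed

lemma laminar_dyadic_tree: "laminar (dyadic_tree N I0)"
  unfolding laminar_def
proof (intro ballI)
  fix X Y assume "X \<in> dyadic_tree N I0" "Y \<in> dyadic_tree N I0"
  then obtain n k m l :: int
    where X: "X = {of_int k * 2 powi (- n) ..< (of_int k + 1) * 2 powi (- n)}"
      and Y: "Y = {of_int l * 2 powi (- m) ..< (of_int l + 1) * 2 powi (- m)}"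
    unfolding dyadic_tree_def dyadic_interval_def by blast
  show "X \<subseteq> Y \<or> Y \<subseteq> X \<or> disjnt X Y"
    using dyadic_interval_nested[of n m l k] dyadic_interval_nested[of m n k l]
      dyadic_interval_nested[of n m k l]
    unfolding X Y by (metis disjnt_sym linear)
qed

lemma len_pos: "dyadic_interval I \<Longrightarrow> 0 < len I"
  unfolding dyadic_interval_def by (auto simp only: len_dyadic) simp

theorem theorem1p3:
  fixes N :: nat and I0 :: "real set" and lam \<alpha> :: "real set \<Rightarrow> real"
  assumes "dyadic_interval I0"
    and "\<And>I. I \<in> dyadic_tree N I0 \<Longrightarrow> lam I \<ge> 0"
    and "\<And>I. I \<in> dyadic_tree N I0 \<Longrightarrow> \<alpha> I \<ge> 0"
    and "\<And>I. I \<in> dyadic_tree N I0 \<Longrightarrow>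
      (1 / len I) * (\<Sum>K\<in>subtree N I0 I. \<alpha> K * (tree_avg N I0 lam K)\<^sup>2) \<le> tree_avg N I0 lam I"
  shows "\<forall>\<phi> :: real set \<Rightarrow> real.
      (1 / len I0) * (\<Sum>I\<in>subtree N I0 I0. \<alpha> I * (tree_avg N I0 (\<lambda>K. \<phi> K * sqrt (lam K)) I)\<^sup>2)
        \<le> 4 * tree_avg N I0 (\<lambda>I. (\<phi> I)\<^sup>2) I0"
proof
  fix \<phi> :: "real set \<Rightarrow> real"
  define T where "T = dyadic_tree N I0"
  define a where "a K = \<alpha> K / (len K)\<^sup>2" for K
  have sub: "subtree N I0 = below T"
    by (simp add: fun_eq_iff subtree_def below_def T_def)
  have weight: "\<alpha> K * (tree_avg N I0 f K)\<^sup>2 = a K * (sum f (below T K))\<^sup>2" for f K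
    by (simp add: tree_avg_def sub a_def power_divide)
  have pos: "0 < len K" if "K \<in> T" for K
    using that len_pos by (simp add: T_def dyadic_tree_def)
  have I0: "I0 \<in> T"
    using assms(1) len_pos[OF assms(1)]
    by (simp add: T_def dyadic_tree_def mult_le_cancel_right1 power_le_one)
  have "(\<Sum>K\<in>below T I0. a K * (\<Sum>J\<in>below T K. \<phi> J * sqrt (lam J))\<^sup>2)
      \<le> 4 * (\<Sum>K\<in>below T I0. (\<phi> K)\<^sup>2)"
  proof (rule laminar_carleson_embedding)
    show "finite T" "laminar T"
      using finite_dyadic_tree[OF assms(1)] laminar_dyadic_tree by (simp_all add: T_def)
    show "{} \<notin> T"
      using pos by force
    show "0 \<le> lam K" "0 \<le> a K" if "K \<in> T" for K
      using assms(2,3) that by (simp_all add: T_def a_def)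
    \<comment> \<open>Both sides of the hypothesis carry the positive factor
      \<open>1 / len I\<close>, which cancels.\<close>
    show "(\<Sum>K\<in>below T I. a K * (sum lam (below T K))\<^sup>2) \<le> sum lam (below T I)" if "I \<in> T" for I
      using assms(4)[of I] that pos[OF that]
      by (simp add: weight sub) (simp add: T_def tree_avg_def sub divide_le_cancel)
  qed (rule I0)
  then show "(1 / len I0) * (\<Sum>I\<in>subtree N I0 I0.
      \<alpha> I * (tree_avg N I0 (\<lambda>K. \<phi> K * sqrt (lam K)) I)\<^sup>2)
        \<le> 4 * tree_avg N I0 (\<lambda>I. (\<phi> I)\<^sup>2) I0"
    unfolding weight sub
    using pos[OF I0] by (simp add: tree_avg_def sub divide_right_mono)
qed

end
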